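(* Let $n$, $m$, and $k$ be nonnegative integers such that $m\le n$ and $k\le \lfloor (n-m)/2\rfloor$. Then $$N^{(m)}_{n,k}(q) = \sum_{s=0}^{k} q^{s(s+m)} \begin{bmatrix} n-m\\ 2s\end{bmatrix}_q T_{m,s}(q) \begin{bmatrix} n-2s-m\\ k-s\end{bmatrix}_q.$$ (Here $m$ need not be greater than or equal to $s$ in $T_{m,s}(q)$.)
   Context: $q$ is an indeterminate. $[i]_q=\frac{1-q^i}{1-q}$, $[k]_q!=\prod_{i=1}^k [i]_q$, and $\begin{bmatrix} n\\k\end{bmatrix}_q=\frac{[n]_q!}{[k]_q![n-k]_q!}$ for $0\le k\le n$. The $q$-super Catalan numbers are, for all nonnegative integers $n,m$, $T_{n,m}(q)=\frac{[2m]_q!\,[2n]_q!}{[m]_q!\,[n]_q!\,[m+n]_q!}$. For nonnegative integers $m\le n$ and $k\le n-m$, the $q$-$m$-Narayana numbers are $N^{(m)}_{n,k}(q)=\begin{bmatrix} 2m\\ m\end{bmatrix}_q\begin{bmatrix} n\\ m\end{bmatrix}_q^{-1}\begin{bmatrix} n\\ k\end{bmatrix}_q\begin{bmatrix} n\\ k+m\end{bmatrix}_q$. *)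

theory Defs
  imports Complex_Main "HOL-Computational_Algebra.Polynomial"
    "HOL-Computational_Algebra.Fraction_Field"
begin

text \<open>
  The q-analogues are given for an element \<open>q\<close> of an arbitrary field; they have
  their intended meaning when \<open>q\<close> is not a root of unity (in particular \<open>q \<noteq> 1\<close>),
  as is the case for \<open>qvar\<close> below.
\<close>

definition qint :: "'a::field \<Rightarrow> nat \<Rightarrow> 'a" where
  "qint q i = (1 - q ^ i) / (1 - q)"

definition qfact :: "'a::field \<Rightarrow> nat \<Rightarrow> 'a" where
  "qfact q k = (\<Prod>i = 1..k. qint q i)"

text \<open>Only meaningful for \<open>k \<le> n\<close>: otherwise \<open>n - k\<close> is truncated to \<open>0\<close>.\<close>

definition qbinom :: "'a::field \<Rightarrow> nat \<Rightarrow> nat \<Rightarrow> 'a" where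
  "qbinom q n k = qfact q n / (qfact q k * qfact q (n - k))"

definition q_super_catalan :: "'a::field \<Rightarrow> nat \<Rightarrow> nat \<Rightarrow> 'a" where
  "q_super_catalan q n m =
     (qfact q (2 * m) * qfact q (2 * n)) / (qfact q m * qfact q n * qfact q (m + n))"

text \<open>Only meaningful for \<open>m \<le> n\<close> and \<open>k \<le> n - m\<close>.\<close>

definition q_narayana :: "'a::field \<Rightarrow> nat \<Rightarrow> nat \<Rightarrow> nat \<Rightarrow> 'a" where
  "q_narayana q m n k =
     qbinom q (2 * m) m * inverse (qbinom q n m) * qbinom q n k * qbinom q n (k + m)"

text \<open>The indeterminate, as an element of the field of rational functions over the rationals.\<close>

definition qvar :: "rat poly fract" where
  "qvar = Fract [:0, 1:] 1"

end

(* After cancelling the q-factorials common to both sides, the identity becomes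
     [n, k+m] = sum over s of q^(s(s+m)) [k, s] [n-k, m+s],
   which is the q-Chu-Vandermonde identity.  The latter is proved by induction on k: one of the
   two q-Pascal rules expands the left-hand side, and the other one recombines the coefficients
   of [n-k, m+s]. *)
theory Submission imports Defs begin

lemma qfact_0 [simp]: "qfact q 0 = 1"
  by (simp add: qfact_def)

lemma qfact_Suc: "qfact q (Suc n) = qint q (Suc n) * qfact q n"
  by (simp add: qfact_def mult.commute)

lemma qint_add: "qint q (i + j) = qint q i + q ^ i * qint q j"
  by (simp add: qint_def add_divide_distrib [symmetric] power_add algebra_simps)

text \<open>Unlike \<open>qbinom\<close>, this vanishes for \<open>k > n\<close>.\<close>

definition gauss_binom :: "'a::field \<Rightarrow> nat \<Rightarrow> nat \<Rightarrow> 'a" where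
  "gauss_binom q n k = (if k \<le> n then qbinom q n k else 0)"

lemma gauss_binom_eq_0 [simp]: "n < k \<Longrightarrow> gauss_binom q n k = 0"
  by (simp add: gauss_binom_def)

text \<open>Writing the upper index as a sum keeps truncated subtraction out of later
  calculations.\<close>

lemma gauss_binom_add_left: "gauss_binom q (k + d) k = qfact q (k + d) / (qfact q k * qfact q d)"
  by (simp add: gauss_binom_def qbinom_def)

context
  fixes q :: "'a::field"
  assumes power_neq_1: "\<And>i. 0 < i \<Longrightarrow> q ^ i \<noteq> 1"
begin

lemma qint_nonzero: "0 < i \<Longrightarrow> qint q i \<noteq> 0"
  \<comment> \<open>The instance at 1 keeps the denominator \<open>1 - q\<close> away from 0, where
    division would return 0.\<close>
  using power_neq_1 [of i] power_neq_1 [of 1] by (simp add: qint_def)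

lemma qfact_nonzero: "qfact q n \<noteq> 0"
  by (simp add: qfact_def qint_nonzero)

lemma gauss_binom_0 [simp]: "gauss_binom q n 0 = 1"
  by (simp add: gauss_binom_def qbinom_def qfact_nonzero)

lemma gauss_binom_self [simp]: "gauss_binom q n n = 1"
  by (simp add: gauss_binom_def qbinom_def qfact_nonzero)

text \<open>In the main case, the leading factor \<open>qint q (Suc n)\<close> of the numerator
  splits by \<open>qint_add\<close> at \<open>Suc k\<close>; each summand cancels one factor of the
  denominator.\<close>

lemma gauss_binom_Suc_Suc:
  "gauss_binom q (Suc n) (Suc k) = gauss_binom q n k + q ^ Suc k * gauss_binom q n (Suc k)"
proof -
  consider "n < k" | "n = k" | d where "n = Suc k + d"
    by (metis less_imp_Suc_add linorder_neqE_nat add_Suc)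
  then show ?thesis
  proof cases
    case 3
    have split: "qint q (Suc n) = qint q (Suc k) + q ^ Suc k * qint q (Suc d)"
      using qint_add [of q "Suc k" "Suc d"] 3 by simp
    have lhs: "gauss_binom q (Suc n) (Suc k)
        = qint q (Suc n) * qfact q n / (qfact q (Suc k) * qfact q (Suc d))"
      using gauss_binom_add_left [of q "Suc k" "Suc d"] 3 by (simp add: qfact_Suc)
    have rhs: "gauss_binom q n k = qfact q n / (qfact q k * qfact q (Suc d))"
      "gauss_binom q n (Suc k) = qfact q n / (qfact q (Suc k) * qfact q d)"
      using gauss_binom_add_left [of q k "Suc d"] gauss_binom_add_left [of q "Suc k" d] 3
      by simp_all
    show ?thesis
      unfolding lhs rhs split qfact_Suc [of q k] qfact_Suc [of q d]
      by (simp add: qfact_nonzero qint_nonzero field_simps)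
  qed auto
qed

lemma gauss_binom_symmetric: "k \<le> n \<Longrightarrow> gauss_binom q n (n - k) = gauss_binom q n k"
  by (simp add: gauss_binom_def qbinom_def mult.commute)

text \<open>This is the first Pascal rule conjugated by the symmetry that replaces the lower index
  by its complement.\<close>

lemma gauss_binom_Suc_Suc':
  assumes "k \<le> n"
  shows "gauss_binom q (Suc n) (Suc k) = q ^ (n - k) * gauss_binom q n k + gauss_binom q n (Suc k)"
proof (cases "k = n")
  case False
  with assms obtain d where n: "n = Suc k + d"
    by (metis le_neq_implies_less less_imp_Suc_add add_Suc)
  have "gauss_binom q (Suc n) (Suc k) = gauss_binom q (Suc n) (Suc d)"
    using gauss_binom_symmetric [of "Suc k" "Suc n"] n by simp
  also have "\<dots> = gauss_binom q n d + q ^ Suc d * gauss_binom q n (Suc d)"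
    by (rule gauss_binom_Suc_Suc)
  also have "gauss_binom q n d = gauss_binom q n (Suc k)"
    using gauss_binom_symmetric [of "Suc k" n] n by simp
  also have "gauss_binom q n (Suc d) = gauss_binom q n k"
    using gauss_binom_symmetric [of k n] n by simp
  finally show ?thesis
    using n by (simp add: add.commute)
qed simp

lemma gauss_binom_Vandermonde:
  "gauss_binom q (k + b) (k + m) =
    (\<Sum>s\<le>k. q ^ (s * (s + m)) * gauss_binom q k s * gauss_binom q b (m + s))"
\<comment> \<open>The Pascal rule produces lower indices \<open>k + m\<close> and
  \<open>k + (m + 1)\<close>, so the induction hypothesis is needed at both \<open>m\<close> and
  \<open>m + 1\<close>.\<close>
proof (induction k arbitrary: m)
  case (Suc k)
  let ?B = "\<lambda>s. gauss_binom q b (m + s)"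
  \<comment> \<open>The exponents are regrouped to match index \<open>Suc s\<close> of the target
    sum; the leftover \<open>q ^ (k - s)\<close> is the weight in
    \<open>gauss_binom_Suc_Suc'\<close>.\<close>
  have shift: "q ^ (k + m + 1) * gauss_binom q (k + b) (k + (m + 1))
      = (\<Sum>s\<le>k. q ^ (Suc s * (Suc s + m)) * (q ^ (k - s) * gauss_binom q k s) * ?B (Suc s))"
    unfolding Suc.IH [of "m + 1"] sum_distrib_left
  proof (rule sum.cong [OF refl])
    fix s assume "s \<in> {..k}"
    then have "k + m + 1 + s * (s + (m + 1)) = Suc s * (Suc s + m) + (k - s)"
      by (simp add: algebra_simps)
    then have "q ^ (k + m + 1) * q ^ (s * (s + (m + 1))) = q ^ (Suc s * (Suc s + m)) * q ^ (k - s)"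
      by (simp only: power_add [symmetric])
    then show "q ^ (k + m + 1) *
        (q ^ (s * (s + (m + 1))) * gauss_binom q k s * gauss_binom q b (m + 1 + s))
        = q ^ (Suc s * (Suc s + m)) * (q ^ (k - s) * gauss_binom q k s) * ?B (Suc s)"
      by (simp only: mult.assoc [symmetric] add_Suc_right add_Suc One_nat_def add_0_right)
  qed
  \<comment> \<open>The added term at \<open>Suc k\<close> is zero; splitting off index 0 then
    leaves the same range as in \<open>shift\<close>.\<close>
  have "gauss_binom q (k + b) (k + m) = (\<Sum>s\<le>Suc k. q ^ (s * (s + m)) * gauss_binom q k s * ?B s)"
    unfolding Suc.IH [of m] by simp
  also have "\<dots> = ?B 0
      + (\<Sum>s\<le>k. q ^ (Suc s * (Suc s + m)) * gauss_binom q k (Suc s) * ?B (Suc s))"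
    by (simp only: sum.atMost_Suc_shift gauss_binom_0) simp
  finally have "gauss_binom q (Suc k + b) (Suc k + m) = ?B 0
      + (\<Sum>s\<le>k. q ^ (Suc s * (Suc s + m)) * gauss_binom q k (Suc s) * ?B (Suc s))
      + (\<Sum>s\<le>k. q ^ (Suc s * (Suc s + m)) * (q ^ (k - s) * gauss_binom q k s) * ?B (Suc s))"
    using gauss_binom_Suc_Suc [of "k + b" "k + m"] shift by simp
  also have "\<dots> = ?B 0
      + (\<Sum>s\<le>k. q ^ (Suc s * (Suc s + m)) * gauss_binom q (Suc k) (Suc s) * ?B (Suc s))"
    unfolding add.assoc sum.distrib [symmetric]
    by (intro arg_cong2 [where f = "(+)"] sum.cong refl)
      (simp only: atMost_iff gauss_binom_Suc_Suc' distrib_left distrib_right add.commute)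
  also have "\<dots> = (\<Sum>s\<le>Suc k. q ^ (s * (s + m)) * gauss_binom q (Suc k) s * ?B s)"
    by (simp only: sum.atMost_Suc_shift gauss_binom_0) simp
  finally show ?case .
qed simp

lemma q_narayana_expansion:
  assumes "m \<le> n" and "k \<le> (n - m) div 2"
  shows "q_narayana q m n k =
    (\<Sum>s = 0..k. q ^ (s * (s + m)) * qbinom q (n - m) (2 * s) *
       q_super_catalan q m s * qbinom q (n - 2 * s - m) (k - s))"
proof -
  \<comment> \<open>\<open>C\<close> is what remains of the Narayana number, free of
    \<open>s\<close>, once \<open>gauss_binom q n (k + m)\<close> is factored out.\<close>
  define C where "C = qfact q (2 * m) * qfact q (n - m) / (qfact q m * qfact q k * qfact q (n - k))"
  have le: "m + 2 * k \<le> n"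
    using assms by linarith
  have "q_narayana q m n k = C * gauss_binom q n (k + m)"
    using le by (simp add: q_narayana_def qbinom_def gauss_binom_def C_def qfact_nonzero mult_2
        field_simps)
  also have "gauss_binom q n (k + m)
      = (\<Sum>s\<le>k. q ^ (s * (s + m)) * gauss_binom q k s * gauss_binom q (n - k) (m + s))"
    using gauss_binom_Vandermonde [of k "n - k" m] le by simp
  also have "C * \<dots> = (\<Sum>s = 0..k. q ^ (s * (s + m)) * qbinom q (n - m) (2 * s) *
       q_super_catalan q m s * qbinom q (n - 2 * s - m) (k - s))"
    unfolding sum_distrib_left atLeast0AtMost
  proof (rule sum.cong [OF refl])
    fix s assume "s \<in> {..k}"
    then obtain j where k: "k = s + j"
      by (auto dest: le_Suc_ex)
    \<comment> \<open>Here the bound on \<open>k\<close> enters: with \<open>j\<close> and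
      \<open>d\<close> every difference of indices becomes a sum.\<close>
    obtain d where n: "n = m + 2 * k + d"
      using le le_Suc_ex by blast
    have "gauss_binom q k s = qfact q k / (qfact q s * qfact q j)"
      using k gauss_binom_add_left [of q s j] by simp
    moreover have "n - k = m + s + (j + d)"
      using k n by simp
    then have "gauss_binom q (n - k) (m + s)
        = qfact q (n - k) / (qfact q (m + s) * qfact q (j + d))"
      by (simp only: gauss_binom_add_left)
    moreover have "n - m - 2 * s = 2 * j + d"
      using k n by simp
    then have "qbinom q (n - m) (2 * s)
        = qfact q (n - m) / (qfact q (2 * s) * qfact q (2 * j + d))"
      by (simp only: qbinom_def)
    moreover have "n - 2 * s - m = 2 * j + d" "k - s = j" "2 * j + d - j = j + d"
      using k n by auto
    then have "qbinom q (n - 2 * s - m) (k - s)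
        = qfact q (2 * j + d) / (qfact q j * qfact q (j + d))"
      by (simp only: qbinom_def)
    ultimately show "C * (q ^ (s * (s + m)) * gauss_binom q k s * gauss_binom q (n - k) (m + s))
        = q ^ (s * (s + m)) * qbinom q (n - m) (2 * s) * q_super_catalan q m s
          * qbinom q (n - 2 * s - m) (k - s)"
      \<comment> \<open>The factorials of \<open>k\<close> and \<open>n - k\<close> cancel on the
        left, those of \<open>2 * s\<close> and \<open>2 * j + d\<close> on the right.\<close>
      by (simp only: C_def q_super_catalan_def add.commute [of s m])
        (simp add: qfact_nonzero mult_ac)
  qed
  finally show ?thesis .
qed

end

lemma qvar_power: "qvar ^ i = Fract (monom 1 i) 1"
  by (induction i) (simp_all add: qvar_def One_fract_def monom_Suc)

text \<open>Equality would identify polynomials of degrees \<open>i\<close> and 0. This makes the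
  results for a general \<open>q\<close> applicable to \<open>qvar\<close>.\<close>

lemma qvar_power_neq_1: "0 < i \<Longrightarrow> qvar ^ i \<noteq> 1"
  by (auto simp: qvar_power One_fract_def eq_fract dest: arg_cong [where f = degree]
      simp: degree_monom_eq)

theorem proposition16:
  fixes n m k :: nat
  assumes "m \<le> n" and "k \<le> (n - m) div 2"
  shows "q_narayana qvar m n k =
    (\<Sum>s = 0..k. qvar ^ (s * (s + m)) * qbinom qvar (n - m) (2 * s) *
       q_super_catalan qvar m s * qbinom qvar (n - 2 * s - m) (k - s))"
  using qvar_power_neq_1 assms by (rule q_narayana_expansion)

end
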